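(* For every $n\ge 0$ there is a bijection $\Phi:\mathcal{HM}_{n}\to\mathcal{SM}_{n}^{U*}$ such that, whenever $(M,P)\in\mathcal{HM}_{n}$ and $L=\Phi(M,P)$, the Motzkin path $M$ has exactly $k$ humps if and only if $L\in\mathcal{SM}_{n}^{UU}(k-1)\cup\mathcal{SM}_{n}^{UD}(k)$.
   Context: A Motzkin path of order $n$ is a lattice path from $(0,0)$ to $(n,0)$ with steps $U=(1,1)$, $D=(1,-1)$, $F=(1,0)$ that never goes below the $x$-axis; $\mathcal{M}_n$ denotes the set of these. A super Motzkin path of order $n$ is such a path (from $(0,0)$ to $(n,0)$ with steps $U,D,F$) with no restriction on going below the $x$-axis; $\mathcal{SM}_n$ denotes the set of these. A hump of a path is a maximal-pattern occurrence of consecutive steps consisting of a $U$ step, followed by zero or more $F$ steps, followed by a $D$ step (i.e. a factor $UF^jD$, $j\ge 0$). $\mathcal{HM}_n=\{(M,P): M\in\mathcal{M}_n,\ P \text{ is a hump of } M\}$. $\mathcal{SM}_n^{U*}$ is the set of paths in $\mathcal{SM}_n$ whose first non-flat (i.e. non-$F$) step is $U$. $\mathcal{SM}_n^{UU}(k)$ (resp. $\mathcal{SM}_n^{UD}(k)$) is the set of paths in $\mathcal{SM}_n$ with exactly $k$ humps whose first non-flat step is $U$ and whose last non-flat step is $U$ (resp. $D$). *)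

theory Defs
  imports Main "HOL-Library.Product_Plus"
begin

text \<open>A lattice path is the list of its steps; it starts at the origin.\<close>

datatype step = Up | Down | Flat

fun step_vec :: "step \<Rightarrow> int \<times> int" where
  "step_vec Up = (1, 1)"
| "step_vec Down = (1, -1)"
| "step_vec Flat = (1, 0)"

definition end_point :: "step list \<Rightarrow> int \<times> int" where
  "end_point p = sum_list (map step_vec p)"

definition super_motzkin :: "nat \<Rightarrow> step list set" where
  "super_motzkin n = {p. end_point p = (int n, 0)}"

definition motzkin :: "nat \<Rightarrow> step list set" where
  "motzkin n = {p \<in> super_motzkin n. \<forall>i \<le> length p. 0 \<le> snd (end_point (take i p))}"

text \<open>A hump is an occurrence of a factor \<open>U F\<^sup>j D\<close>, recorded as the pair \<open>(i, j)\<close> of the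
  number \<open>i\<close> of steps preceding it and the number \<open>j\<close> of its flat steps.\<close>

definition humps :: "step list \<Rightarrow> (nat \<times> nat) set" where
  "humps p = {(i, j). \<exists>xs ys. length xs = i \<and> p = xs @ [Up] @ replicate j Flat @ [Down] @ ys}"

definition num_humps :: "step list \<Rightarrow> nat" where
  "num_humps p = card (humps p)"

definition humped_motzkin :: "nat \<Rightarrow> (step list \<times> (nat \<times> nat)) set" where
  "humped_motzkin n = {(M, P). M \<in> motzkin n \<and> P \<in> humps M}"

definition nonflat_steps :: "step list \<Rightarrow> step list" where
  "nonflat_steps p = filter (\<lambda>s. s \<noteq> Flat) p"

definition first_nonflat_is :: "step \<Rightarrow> step list \<Rightarrow> bool" where
  "first_nonflat_is s p \<longleftrightarrow> nonflat_steps p \<noteq> [] \<and> hd (nonflat_steps p) = s"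

definition last_nonflat_is :: "step \<Rightarrow> step list \<Rightarrow> bool" where
  "last_nonflat_is s p \<longleftrightarrow> nonflat_steps p \<noteq> [] \<and> last (nonflat_steps p) = s"

definition super_motzkin_U :: "nat \<Rightarrow> step list set" where
  "super_motzkin_U n = {p \<in> super_motzkin n. first_nonflat_is Up p}"

text \<open>The hump count \<open>k\<close> is an integer so that index \<open>k - 1\<close> is not truncated at
  \<open>k = 0\<close>; for negative \<open>k\<close> the following sets are empty.\<close>

definition super_motzkin_UU :: "nat \<Rightarrow> int \<Rightarrow> step list set" where
  "super_motzkin_UU n k =
     {p \<in> super_motzkin n. int (num_humps p) = k \<and> first_nonflat_is Up p \<and> last_nonflat_is Up p}"

definition super_motzkin_UD :: "nat \<Rightarrow> int \<Rightarrow> step list set" where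
  "super_motzkin_UD n k =
     {p \<in> super_motzkin n. int (num_humps p) = k \<and> first_nonflat_is Up p \<and> last_nonflat_is Down p}"

end

theory Submission
  imports Defs
begin

text \<open>
  Append a final \<open>D\<close> to a Motzkin path \<open>M\<close> and read the word \<open>M D\<close> cyclically. By the cycle lemma,
  every word of total height \<open>-1\<close> has exactly one rotation of the form \<open>M D\<close> with \<open>M\<close> a Motzkin
  path. The rotations of \<open>M D\<close> of the form \<open>L D\<close>, where the first non-flat step of \<open>L\<close> is \<open>U\<close>,
  correspond to the cyclic valleys \<open>D F\<^sup>j U\<close>; humps and valleys alternate around the cycle, so there
  are as many of them as there are humps of \<open>M\<close>. Cutting after a \<open>D\<close> destroys no hump, hence \<open>L D\<close>
  has as many humps as \<open>M D\<close>, that is, as \<open>M\<close>; and \<open>L D\<close> has one hump more than \<open>L\<close>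
  exactly if the last non-flat step of \<open>L\<close> is \<open>U\<close>.
\<close>

section \<open>First and last non-flat steps\<close>

lemma first_nonflat_is_Nil [simp]: "\<not> first_nonflat_is s []"
  by (simp add: first_nonflat_is_def nonflat_steps_def)

lemma first_nonflat_is_Cons [simp]:
  "first_nonflat_is s (x # p) \<longleftrightarrow> (if x = Flat then first_nonflat_is s p else x = s)"
  by (auto simp: first_nonflat_is_def nonflat_steps_def)

lemma last_nonflat_is_Nil [simp]: "\<not> last_nonflat_is s []"
  by (simp add: last_nonflat_is_def nonflat_steps_def)

lemma last_nonflat_is_Cons [simp]:
  "last_nonflat_is s (x # p) \<longleftrightarrow>
    (if x = Flat \<or> nonflat_steps p \<noteq> [] then last_nonflat_is s p else x = s)"
  by (auto simp: last_nonflat_is_def nonflat_steps_def)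

lemma first_nonflat_is_append_Down:
  "last p = Down \<Longrightarrow> p \<noteq> [] \<Longrightarrow> first_nonflat_is s (p @ q) \<longleftrightarrow> first_nonflat_is s p"
  by (induction p) (auto split: if_splits)

lemma first_nonflat_is_Up_snoc_Down:
  "first_nonflat_is Up (p @ [Down]) \<longleftrightarrow> first_nonflat_is Up p"
  by (induction p) auto

lemma first_nonflat_is_Down_snoc_Down:
  "first_nonflat_is Down (p @ [Down]) \<longleftrightarrow> first_nonflat_is Down p \<or> nonflat_steps p = []"
  by (induction p) (auto simp: nonflat_steps_def)

lemma first_nonflat_is_Down_iff_not_Up:
  "last p = Down \<Longrightarrow> p \<noteq> [] \<Longrightarrow> first_nonflat_is Down p \<longleftrightarrow> \<not> first_nonflat_is Up p"
  by (induction p) (auto split: if_splits, (metis step.exhaust)+)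

lemma last_nonflat_is_Up_or_Down:
  "nonflat_steps p \<noteq> [] \<Longrightarrow> last_nonflat_is Down p \<longleftrightarrow> \<not> last_nonflat_is Up p"
proof -
  assume "nonflat_steps p \<noteq> []"
  then have "last (nonflat_steps p) \<noteq> Flat"
    using last_in_set[of "nonflat_steps p"] by (auto simp: nonflat_steps_def)
  then show ?thesis using \<open>nonflat_steps p \<noteq> []\<close>
    by (cases "last (nonflat_steps p)") (simp_all add: last_nonflat_is_def)
qed

section \<open>Heights and Motzkin paths\<close>

definition height :: "step list \<Rightarrow> int" where
  "height p = snd (end_point p)"

lemma height_Nil [simp]: "height [] = 0"
  by (simp add: height_def end_point_def)

lemma height_Cons [simp]: "height (x # p) = snd (step_vec x) + height p"
  by (simp add: height_def end_point_def)

lemma height_append [simp]: "height (p @ q) = height p + height q"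
  by (induction p) auto

lemma end_point_eq: "end_point p = (int (length p), height p)"
proof (induction p)
  case (Cons x p)
  then show ?case by (cases x) (auto simp: end_point_def height_def prod_eq_iff)
qed (simp add: end_point_def zero_prod_def)

lemma super_motzkin_iff: "p \<in> super_motzkin n \<longleftrightarrow> length p = n \<and> height p = 0"
  by (auto simp: super_motzkin_def end_point_eq)

lemma motzkin_iff:
  "p \<in> motzkin n \<longleftrightarrow> length p = n \<and> height p = 0 \<and> (\<forall>xs ys. p = xs @ ys \<longrightarrow> 0 \<le> height xs)"
proof -
  have "(\<forall>i\<le>length p. 0 \<le> height (take i p)) \<longleftrightarrow> (\<forall>xs ys. p = xs @ ys \<longrightarrow> 0 \<le> height xs)"
    by (metis append_eq_conv_conj append_take_drop_id le_add1 length_append)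
  then show ?thesis by (simp add: motzkin_def super_motzkin_iff flip: height_def)
qed

text \<open>Cut before the last \<open>Up\<close>: the suffix is that \<open>Up\<close> followed by
  flat steps. In a Motzkin path the prefix left over would have height -1.\<close>

lemma last_nonflat_is_Up_split:
  "last_nonflat_is Up p \<Longrightarrow> \<exists>xs ys. p = xs @ ys \<and> height ys = 1"
proof (induction p)
  case (Cons x p)
  show ?case
  proof (cases "x = Flat \<or> nonflat_steps p \<noteq> []")
    case True
    with Cons show ?thesis by (metis append_Cons last_nonflat_is_Cons)
  next
    case False
    then have "x = Up" using Cons.prems by simp
    moreover have "nonflat_steps q = [] \<Longrightarrow> height q = 0" for q
      by (induction q) (auto simp: nonflat_steps_def split: if_splits)
    ultimately have "height (x # p) = 1" using False by simp
    then show ?thesis by (metis append_Nil)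
  qed
qed simp

lemma motzkin_not_last_nonflat_Up: "p \<in> motzkin n \<Longrightarrow> \<not> last_nonflat_is Up p"
  using last_nonflat_is_Up_split[of p] by (fastforce simp: motzkin_iff)

lemma first_nonflat_is_Down_iff:
  "first_nonflat_is Down p \<longleftrightarrow> (\<exists>j ys. p = replicate j Flat @ Down # ys)"
proof
  show "first_nonflat_is Down p \<Longrightarrow> \<exists>j ys. p = replicate j Flat @ Down # ys"
  proof (induction p)
    case (Cons x p)
    show ?case
    proof (cases "x = Flat")
      case True
      then show ?thesis using Cons by (metis append_Cons first_nonflat_is_Cons replicate_Suc)
    next
      case False
      then show ?thesis using Cons.prems by (intro exI[of _ 0]) auto
    qed
  qed simp
next
  have "first_nonflat_is Down (replicate j Flat @ Down # ys)" for j ys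
    by (induction j) auto
  then show "\<exists>j ys. p = replicate j Flat @ Down # ys \<Longrightarrow> first_nonflat_is Down p" by blast
qed

section \<open>Counting humps\<close>

lemma humps_Nil [simp]: "humps [] = {}"
  by (simp add: humps_def)

text \<open>The number of flat steps of a hump is forced by its starting position, so a new first
  step adds at most one hump. This recursion makes hump counts accessible to structural
  induction.\<close>

lemma humps_Cons:
  "humps (x # p) =
    (if x = Up \<and> first_nonflat_is Down p then {(0, length (takeWhile ((=) Flat) p))} else {})
    \<union> apfst Suc ` humps p" (is "_ = ?A \<union> _")
proof -
  have len: "length (takeWhile ((=) Flat) (replicate j Flat @ Down # ys)) = j" for j ys
    by (induction j) auto
  have "(i, j) \<in> humps (x # p) \<longleftrightarrow> (i, j) \<in> ?A \<union> apfst Suc ` humps p" for i j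
  proof (cases i)
    case 0
    then show ?thesis
      using len by (auto simp: humps_def first_nonflat_is_Down_iff)
  next
    case (Suc i')
    have "(i, j) \<in> humps (x # p) \<longleftrightarrow> (i', j) \<in> humps p"
      unfolding humps_def Suc by (auto simp: length_Suc_conv Cons_eq_append_conv)
    then show ?thesis using Suc by (force simp: image_iff)
  qed
  then show ?thesis by auto
qed

lemma finite_humps [simp]: "finite (humps p)"
  by (induction p) (auto simp: humps_Cons)

lemma num_humps_Nil [simp]: "num_humps [] = 0"
  by (simp add: num_humps_def)

lemma num_humps_Cons [simp]:
  "num_humps (x # p) = of_bool (x = Up \<and> first_nonflat_is Down p) + num_humps p"
proof -
  have "card (apfst Suc ` humps p) = card (humps p)"
    by (rule card_image) (auto simp: inj_on_def)
  moreover have "(0, j) \<notin> apfst Suc ` humps p" for j by auto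
  ultimately show ?thesis by (simp add: num_humps_def humps_Cons)
qed

text \<open>A hump straddling the cut would use the last step of \<open>p\<close> as its
  \<open>Up\<close> or as one of its flat steps, which \<open>last p = Down\<close>
  excludes.\<close>

lemma num_humps_append:
  "p = [] \<or> last p = Down \<Longrightarrow> num_humps (p @ q) = num_humps p + num_humps q"
proof (induction p)
  case (Cons x p)
  then show ?case by (cases "p = []") (auto simp: first_nonflat_is_append_Down)
qed simp

text \<open>The new \<open>Down\<close> completes a hump exactly when only flat steps separate it
  from a preceding \<open>Up\<close>. This term is the source of the shift between \<open>k\<close>
  and \<open>k - 1\<close>.\<close>

lemma num_humps_snoc_Down:
  "num_humps (p @ [Down]) = num_humps p + of_bool (last_nonflat_is Up p)"
proof (induction p)
  case (Cons x p)
  have "nonflat_steps p = [] \<Longrightarrow> \<not> first_nonflat_is Down p \<and> \<not> last_nonflat_is Up p"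
    by (simp add: first_nonflat_is_def last_nonflat_is_def)
  with Cons show ?case by (auto simp: first_nonflat_is_Down_snoc_Down)
qed simp

section \<open>Valleys and cyclic cuts\<close>

text \<open>A valley is stored as the split of the word around its \<open>Down\<close>, so that the
  rotation at it can be read off directly.\<close>

definition valleys :: "step list \<Rightarrow> (step list \<times> step list) set" where
  "valleys p = {(xs, ys). p = xs @ Down # ys \<and> first_nonflat_is Up ys}"

lemma valleys_Nil [simp]: "valleys [] = {}"
  by (simp add: valleys_def)

lemma valleys_Cons:
  "valleys (x # p) =
    (if x = Down \<and> first_nonflat_is Up p then {([], p)} else {}) \<union> apfst (Cons x) ` valleys p"
  by (auto simp: valleys_def image_iff Cons_eq_append_conv)

lemma finite_valleys [simp]: "finite (valleys p)"
  by (induction p) (auto simp: valleys_Cons)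

lemma card_valleys_Cons [simp]:
  "card (valleys (x # p)) = of_bool (x = Down \<and> first_nonflat_is Up p) + card (valleys p)"
proof -
  have "card (apfst (Cons x) ` valleys p) = card (valleys p)"
    by (rule card_image) (auto simp: inj_on_def)
  moreover have "([], ys) \<notin> apfst (Cons y) ` valleys p" for y ys by auto
  ultimately show ?thesis by (auto simp: valleys_Cons)
qed

text \<open>Up to flat steps, humps are the changes from \<open>Up\<close> to \<open>Down\<close>
  and valleys the changes back, so they alternate. As \<open>p\<close> ends in \<open>Down\<close>,
  the last change is a hump; the first non-flat step decides which kind comes first.\<close>

lemma num_humps_eq_card_valleys:
  "last p = Down \<Longrightarrow> p \<noteq> [] \<Longrightarrow>
    num_humps p = card (valleys p) + of_bool (first_nonflat_is Up p)"
proof (induction p)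
  case (Cons x p)
  then show ?case
    by (cases "p = []"; cases x) (auto simp: first_nonflat_is_Down_iff_not_Up)
qed simp

text \<open>The cuts of \<open>w\<close> are its cyclic valleys: the cut with \<open>xs = []\<close> is the valley across the end of
  \<open>w\<close>, if \<open>w\<close> ends in \<open>D\<close>.\<close>

definition cuts :: "step list \<Rightarrow> (step list \<times> step list) set" where
  "cuts w = {(xs, ys). xs @ ys = w \<and> (xs = [] \<or> last xs = Down) \<and> first_nonflat_is Up ys}"

text \<open>For \<open>w\<close> ending in \<open>Down\<close>, the prepended \<open>Down\<close>
  stands for the last step of \<open>w\<close> on the cycle, so the cut with \<open>xs = []\<close>
  becomes an ordinary valley. The map puts the \<open>Down\<close> of the valley at the end of the
  first piece, and \<open>tl\<close> removes the prepended step.\<close>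

lemma cuts_eq_image_valleys:
  "cuts w = (\<lambda>(zs, ys). (tl (zs @ [Down]), ys)) ` valleys (Down # w)" (is "_ = ?f ` _")
proof (intro set_eqI iffI)
  fix c assume "c \<in> cuts w"
  then obtain xs ys where c: "c = (xs, ys)" "xs @ ys = w" "xs = [] \<or> last xs = Down"
    and U: "first_nonflat_is Up ys"
    by (auto simp: cuts_def)
  then have snoc: "butlast (Down # xs) @ [Down] = Down # xs"
    by (metis append_butlast_last_id last_ConsL last_ConsR list.distinct(1))
  then have "Down # w = butlast (Down # xs) @ Down # ys"
    using c(2) by (metis append.assoc append_Cons append_Nil)
  then have "(butlast (Down # xs), ys) \<in> valleys (Down # w)"
    using U by (simp add: valleys_def)
  moreover have "?f (butlast (Down # xs), ys) = c"
    using snoc c(1) by (metis (mono_tags) case_prod_conv list.sel(3))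
  ultimately show "c \<in> ?f ` valleys (Down # w)" by (metis imageI)
next
  fix c assume "c \<in> ?f ` valleys (Down # w)"
  then obtain zs ys where c: "c = (tl (zs @ [Down]), ys)" "Down # w = zs @ Down # ys"
    and U: "first_nonflat_is Up ys"
    by (auto simp: valleys_def)
  then show "c \<in> cuts w" by (cases zs) (auto simp: cuts_def)
qed

lemma card_cuts_eq_card_valleys: "card (cuts w) = card (valleys (Down # w))"
proof -
  have "zs = zs'"
    if "(zs, ys) \<in> valleys (Down # w)" "(zs', ys') \<in> valleys (Down # w)"
      and tl: "tl (zs @ [Down]) = tl (zs' @ [Down])" for zs ys zs' ys'
  proof -
    \<comment> \<open>\<open>tl\<close> loses only the head, which is the prepended
      \<open>Down\<close> in both lists.\<close>
    have "hd (zs @ [Down]) = hd (zs' @ [Down])"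
      using that by (cases zs; cases zs') (auto simp: valleys_def)
    with tl have "zs @ [Down] = zs' @ [Down]" by (metis list.expand snoc_eq_iff_butlast)
    then show ?thesis by simp
  qed
  then have "inj_on (\<lambda>(zs, ys). (tl (zs @ [Down]), ys)) (valleys (Down # w))"
    unfolding inj_on_def by (metis (no_types, lifting) case_prod_conv prod.inject surj_pair)
  then show ?thesis unfolding cuts_eq_image_valleys by (rule card_image)
qed

lemma finite_cuts [simp]: "finite (cuts w)"
  by (simp add: cuts_eq_image_valleys)

text \<open>\<open>Down # w\<close> starts and ends with \<open>Down\<close>, so it has equally many
  humps and valleys, and its leading \<open>Down\<close> creates no hump.\<close>

lemma card_cuts: "last w = Down \<Longrightarrow> w \<noteq> [] \<Longrightarrow> card (cuts w) = num_humps w"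
  using num_humps_eq_card_valleys[of "Down # w"]
  by (simp add: card_cuts_eq_card_valleys del: card_valleys_Cons)

section \<open>The cycle lemma\<close>

text \<open>The words \<open>M D\<close> with \<open>M\<close> a Motzkin path, see \<open>first_passage_snoc_iff\<close>.\<close>

definition first_passage :: "step list \<Rightarrow> bool" where
  "first_passage w \<longleftrightarrow> height w = -1 \<and> (\<forall>xs ys. w = xs @ ys \<longrightarrow> ys \<noteq> [] \<longrightarrow> 0 \<le> height xs)"

lemma first_passage_last:
  assumes "first_passage w"
  shows "w \<noteq> []" "last w = Down"
proof -
  show "w \<noteq> []" using assms by (auto simp: first_passage_def)
  then obtain v x where w: "w = v @ [x]" by (metis rev_exhaust)
  then have "0 \<le> height v" "height v + snd (step_vec x) = -1"
    using assms by (auto simp: first_passage_def)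
  then show "last w = Down" using w by (cases x) auto
qed

lemma first_passage_snoc_iff:
  "first_passage (p @ [Down]) \<longleftrightarrow> p \<in> motzkin (length p)"
  unfolding first_passage_def motzkin_iff
  by (auto simp: append_eq_append_conv2 Cons_eq_append_conv append_eq_Cons_conv)

text \<open>If the cuts differ by a nonempty block \<open>us\<close>, then \<open>us\<close> is a
  proper prefix of one rotation and its complement a proper prefix of the other. Both heights are
  nonnegative, yet they add up to -1. Nonempty \<open>ys\<close> and \<open>ys'\<close> select one
  of the two splits that give the trivial rotation.\<close>

lemma cycle_lemma_unique:
  assumes "first_passage (xs @ ys)" "first_passage (xs' @ ys')" "ys @ xs = ys' @ xs'"
    and "ys \<noteq> []" "ys' \<noteq> []"
  shows "ys = ys'" "xs = xs'"
proof -
  have no_shift: "us = []"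
    if "first_passage ((us @ a) @ b)" "first_passage (a @ b @ us)" "b \<noteq> []" for us a b
  proof (rule ccontr)
    assume "us \<noteq> []"
    have "0 \<le> height us"
      using that(1,3) unfolding first_passage_def by (metis append.assoc append_is_Nil_conv)
    moreover have "0 \<le> height (a @ b)"
      using that(2) \<open>us \<noteq> []\<close> unfolding first_passage_def by (metis append.assoc)
    moreover have "height (a @ b @ us) = -1" using that(2) by (simp add: first_passage_def)
    ultimately show False by simp
  qed
  obtain us where "ys = ys' @ us \<and> us @ xs = xs' \<or> ys @ us = ys' \<and> xs = us @ xs'"
    using assms(3) by (auto simp: append_eq_append_conv2)
  then have "ys = ys' \<and> xs = xs'"
  proof
    assume *: "ys = ys' @ us \<and> us @ xs = xs'"
    then have "us = []" using no_shift[of us xs ys'] assms by simp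
    with * show ?thesis by simp
  next
    assume *: "ys @ us = ys' \<and> xs = us @ xs'"
    then have "us = []" using no_shift[of us xs' ys] assms by auto
    with * show ?thesis by simp
  qed
  then show "ys = ys'" "xs = xs'" by auto
qed

text \<open>Rotate at the first position at which the path reaches its minimum.\<close>

lemma cycle_lemma_exists:
  assumes "height w = -1"
  obtains xs ys where "w = ys @ xs" "ys \<noteq> []" "first_passage (xs @ ys)"
proof -
  define h where "h i = height (take i w)" for i
  define m where "m = Min (h ` {..length w})"
  have m_le: "m \<le> h i" if "i \<le> length w" for i
    using that by (auto simp: m_def)
  have "m \<in> h ` {..length w}" unfolding m_def by (rule Min_in) auto
  then have ex: "\<exists>i. i \<le> length w \<and> h i = m" by auto
  define i where "i = (LEAST i. i \<le> length w \<and> h i = m)"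
  have i: "i \<le> length w" "h i = m" using LeastI_ex[OF ex] by (auto simp: i_def)
  have before: "m < h j" if "j < i" for j
  proof -
    have "h j \<noteq> m" using not_less_Least[of j] that i unfolding i_def by fastforce
    then show ?thesis using m_le[of j] that i by simp
  qed
  define ys xs where "ys = take i w" and "xs = drop i w"
  have w: "w = ys @ xs" by (simp add: ys_def xs_def)
  have "m \<le> -1" using m_le[of "length w"] assms by (simp add: h_def)
  moreover have hys: "height ys = m" using i by (simp add: h_def ys_def)
  \<comment> \<open>The path ends below its start, so the minimum is not attained at position
    0.\<close>
  ultimately have "ys \<noteq> []" by auto
  have hxs: "height xs = -1 - m" using assms hys unfolding w by simp
  have "0 \<le> height us" if eq: "xs @ ys = us @ vs" and "vs \<noteq> []" for us vs
  proof -
    consider t where "xs = us @ t" | t where "us = xs @ t" "ys = t @ vs"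
      using eq by (auto simp: append_eq_append_conv2)
    then show ?thesis
    proof cases
      case 1
      have "m \<le> h (length (ys @ us))" by (rule m_le) (simp add: w 1)
      then show ?thesis by (simp add: h_def w 1 hys)
    next
      case 2
      have "length ys = i" using i by (simp add: ys_def)
      \<comment> \<open>Strictness, due to the choice of the first minimum, gains the unit that
        offsets the -1 in \<open>hxs\<close>.\<close>
      then have "m < h (length t)" using 2 \<open>vs \<noteq> []\<close> by (intro before) auto
      then show ?thesis by (simp add: h_def w 2 hxs)
    qed
  qed
  then have "first_passage (xs @ ys)"
    using hys hxs by (simp add: first_passage_def)
  with w \<open>ys \<noteq> []\<close> show ?thesis by (rule that)
qed

section \<open>Rotation at cuts and the bijection\<close>

lemma cuts_rotate:
  assumes M: "M \<in> motzkin n" and cut: "(xs, ys) \<in> cuts (M @ [Down])"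
  defines "L \<equiv> butlast (ys @ xs)"
  shows "L @ [Down] = ys @ xs" "L \<in> super_motzkin_U n"
    and "num_humps M = num_humps L + of_bool (last_nonflat_is Up L)"
proof -
  have w: "xs @ ys = M @ [Down]" and xs: "xs = [] \<or> last xs = Down"
    and U: "first_nonflat_is Up ys"
    using cut by (auto simp: cuts_def)
  have "ys \<noteq> []" using U by auto
  then have ys: "last ys = Down" using w by (metis last_appendR last_snoc)
  show L: "L @ [Down] = ys @ xs"
    using \<open>ys \<noteq> []\<close> xs ys unfolding L_def
    by (metis append_butlast_last_id append_is_Nil_conv append_Nil2 last_appendR)
  have "length L = n" "height L = 0"
    using arg_cong[OF L, of length] arg_cong[OF w, of length]
      arg_cong[OF L, of height] arg_cong[OF w, of height] M by (auto simp: motzkin_iff)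
  moreover have "first_nonflat_is Up (L @ [Down])"
    unfolding L using U ys \<open>ys \<noteq> []\<close> by (simp add: first_nonflat_is_append_Down)
  ultimately show "L \<in> super_motzkin_U n"
    by (simp add: super_motzkin_U_def super_motzkin_iff first_nonflat_is_Up_snoc_Down)
  \<comment> \<open>Each nonempty piece ends in \<open>Down\<close>, so the hump counts of
    \<open>xs\<close> and \<open>ys\<close> add up in either order.\<close>
  have "num_humps (M @ [Down]) = num_humps (L @ [Down])"
    unfolding L w[symmetric] using xs ys by (simp add: num_humps_append)
  then show "num_humps M = num_humps L + of_bool (last_nonflat_is Up L)"
    using motzkin_not_last_nonflat_Up[OF M] by (simp add: num_humps_snoc_Down)
qed

text \<open>This gives surjectivity: the cycle lemma for \<open>L @ [Down]\<close> supplies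
  \<open>M\<close>, and it remains to see that its rotation point is a cut.\<close>

lemma super_motzkin_U_cut:
  assumes L: "L \<in> super_motzkin_U n"
  obtains M xs ys where "M \<in> motzkin n" "(xs, ys) \<in> cuts (M @ [Down])" "L = butlast (ys @ xs)"
proof -
  have len: "length L = n" and "height (L @ [Down]) = -1" and U: "first_nonflat_is Up L"
    using L by (auto simp: super_motzkin_U_def super_motzkin_iff)
  then obtain xs ys where w: "L @ [Down] = ys @ xs" "ys \<noteq> []" and fp: "first_passage (xs @ ys)"
    using cycle_lemma_exists by metis
  obtain M where M: "xs @ ys = M @ [Down]"
    using first_passage_last[OF fp] by (metis append_butlast_last_id)
  have "length M = n" using arg_cong[OF M, of length] arg_cong[OF w(1), of length] len by simp
  then have "M \<in> motzkin n" using fp M by (metis first_passage_snoc_iff)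
  moreover have "(xs, ys) \<in> cuts (M @ [Down])"
  proof -
    \<comment> \<open>Ending in \<open>Down\<close>, \<open>ys\<close> contains a non-flat step, so
      its first one is that of \<open>L @ [Down]\<close>.\<close>
    have "last ys = Down" using w(2) M by (metis last_appendR last_snoc)
    then have "first_nonflat_is Up ys"
      using w U by (metis first_nonflat_is_append_Down first_nonflat_is_Up_snoc_Down)
    moreover have "xs = [] \<or> last xs = Down" using w(1) by (metis last_appendR last_snoc)
    ultimately show ?thesis using M by (simp add: cuts_def)
  qed
  moreover have "L = butlast (ys @ xs)" using w(1) by (metis butlast_snoc)
  ultimately show ?thesis by (rule that)
qed

lemma super_motzkin_UU_UD_iff:
  assumes "L \<in> super_motzkin_U n"
  shows "L \<in> super_motzkin_UU n (k - 1) \<union> super_motzkin_UD n k \<longleftrightarrow>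
    int (num_humps L + of_bool (last_nonflat_is Up L)) = k"
proof -
  have "last_nonflat_is Down L \<longleftrightarrow> \<not> last_nonflat_is Up L"
    using assms by (intro last_nonflat_is_Up_or_Down)
      (auto simp: super_motzkin_U_def first_nonflat_is_def)
  then show ?thesis
    using assms by (auto simp: super_motzkin_U_def super_motzkin_UU_def super_motzkin_UD_def)
qed

theorem theorem1p1:
  fixes n :: nat
  shows "\<exists>\<Phi>. bij_betw \<Phi> (humped_motzkin n) (super_motzkin_U n) \<and>
    (\<forall>M P L. (M, P) \<in> humped_motzkin n \<longrightarrow> L = \<Phi> (M, P) \<longrightarrow>
      (\<forall>k::int. int (num_humps M) = k \<longleftrightarrow>
        L \<in> super_motzkin_UU n (k - 1) \<union> super_motzkin_UD n k))"
proof -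
  \<comment> \<open>All cuts of \<open>M @ [Down]\<close> lead to the same hump condition on
    \<open>L\<close>, so for each \<open>M\<close> any bijection provided by equal cardinalities
    will do.\<close>
  have "\<exists>f. bij_betw f (humps M) (cuts (M @ [Down]))" if "M \<in> motzkin n" for M
  proof (rule finite_same_card_bij)
    show "card (humps M) = card (cuts (M @ [Down]))"
      using motzkin_not_last_nonflat_Up[OF that]
      by (simp add: card_cuts num_humps_snoc_Down flip: num_humps_def)
  qed simp_all
  then obtain f where f: "bij_betw (f M) (humps M) (cuts (M @ [Down]))" if "M \<in> motzkin n" for M
    by metis
  \<comment> \<open>Rotate at the cut assigned to \<open>P\<close>; \<open>butlast\<close> removes
    the \<open>Down\<close> that ends the rotated word.\<close>
  define \<Phi> where "\<Phi> = (\<lambda>(M, P). case f M P of (xs, ys) \<Rightarrow> butlast (ys @ xs))"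
  have cut: "f M P \<in> cuts (M @ [Down])" if "(M, P) \<in> humped_motzkin n" for M P
    using that f[of M] by (auto simp: humped_motzkin_def dest: bij_betwE)
  have \<Phi>: "\<Phi> (M, P) \<in> super_motzkin_U n"
    "num_humps M = num_humps (\<Phi> (M, P)) + of_bool (last_nonflat_is Up (\<Phi> (M, P)))"
    if "(M, P) \<in> humped_motzkin n" for M P
    using cuts_rotate[of M n "fst (f M P)" "snd (f M P)"] cut[OF that] that
    by (auto simp: \<Phi>_def humped_motzkin_def split: prod.splits)
  have "inj_on \<Phi> (humped_motzkin n)"
  proof (rule inj_onI, clarify)
    fix M P M' P'
    assume MP: "(M, P) \<in> humped_motzkin n" and MP': "(M', P') \<in> humped_motzkin n"
      and eq: "\<Phi> (M, P) = \<Phi> (M', P')"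
    obtain xs ys xs' ys' where fP: "f M P = (xs, ys)" and fP': "f M' P' = (xs', ys')"
      by fastforce
    have M: "M \<in> motzkin n" "P \<in> humps M" and M': "M' \<in> motzkin n" "P' \<in> humps M'"
      using MP MP' by (auto simp: humped_motzkin_def)
    have c: "(xs, ys) \<in> cuts (M @ [Down])" and c': "(xs', ys') \<in> cuts (M' @ [Down])"
      using cut[OF MP] cut[OF MP'] fP fP' by auto
    have "butlast (ys @ xs) = butlast (ys' @ xs')"
      using eq fP fP' unfolding \<Phi>_def by (simp only: prod.case)
    then have "ys @ xs = ys' @ xs'"
      using cuts_rotate(1)[OF M(1) c] cuts_rotate(1)[OF M'(1) c'] by metis
    moreover have "ys \<noteq> []" "ys' \<noteq> []" and w: "xs @ ys = M @ [Down]" "xs' @ ys' = M' @ [Down]"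
      using c c' by (auto simp: cuts_def)
    moreover have "first_passage (xs @ ys)" "first_passage (xs' @ ys')"
      unfolding w using M M' by (simp_all add: first_passage_snoc_iff motzkin_iff)
    \<comment> \<open>The cycle lemma recovers the cut from the rotated word; the cut determines
      \<open>M\<close>, and injectivity of \<open>f M\<close> on \<open>humps M\<close> then gives
      \<open>P\<close>.\<close>
    ultimately have "xs = xs'" "ys = ys'" using cycle_lemma_unique by metis+
    with w have "M = M'" by simp
    moreover have "P = P'"
      using f[OF M(1)] M M' fP fP' \<open>M = M'\<close> \<open>xs = xs'\<close> \<open>ys = ys'\<close>
      by (metis bij_betw_inv_into_left)
    ultimately show "M = M' \<and> P = P'" by simp
  qed
  moreover have "\<Phi> ` humped_motzkin n = super_motzkin_U n"
  proof
    show "\<Phi> ` humped_motzkin n \<subseteq> super_motzkin_U n" using \<Phi>(1) by auto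
    show "super_motzkin_U n \<subseteq> \<Phi> ` humped_motzkin n"
    proof
      fix L assume "L \<in> super_motzkin_U n"
      then obtain M xs ys where M: "M \<in> motzkin n" and c: "(xs, ys) \<in> cuts (M @ [Down])"
        and L: "L = butlast (ys @ xs)" by (rule super_motzkin_U_cut)
      obtain P where P: "P \<in> humps M" "f M P = (xs, ys)"
        using f[OF M] c by (metis bij_betw_iff_bijections)
      then have "L = \<Phi> (M, P)" "(M, P) \<in> humped_motzkin n"
        using M L by (auto simp: \<Phi>_def humped_motzkin_def)
      then show "L \<in> \<Phi> ` humped_motzkin n" by blast
    qed
  qed
  ultimately have "bij_betw \<Phi> (humped_motzkin n) (super_motzkin_U n)"
    by (simp add: bij_betw_def)
  moreover have "int (num_humps M) = k \<longleftrightarrow>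
      \<Phi> (M, P) \<in> super_motzkin_UU n (k - 1) \<union> super_motzkin_UD n k"
    if "(M, P) \<in> humped_motzkin n" for M P k
    using \<Phi>[OF that] super_motzkin_UU_UD_iff by simp
  ultimately show ?thesis by blast
qed

end
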